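(* For any odd positive integer $t\geq 825$, $\chi_{\rho}(D(1,t))\leq 30$.
   Context: For positive integers $k<t$, the distance graph $D(k,t)$ is the infinite simple undirected graph with vertex set $\mathbb{Z}$ in which two distinct integers $i,j$ are adjacent if and only if $|i-j|\in\{k,t\}$. For a connected graph $G$, $\mathrm{dist}_G(u,v)$ denotes the graph distance. For a positive integer $i$, an $i$-packing is a set $X_i$ of vertices such that any two distinct $u,v\in X_i$ satisfy $\mathrm{dist}_G(u,v)>i$. A packing $p$-coloring of $G$ is a partition of $V(G)$ into disjoint (possibly empty) classes $X_1,\dots,X_p$ such that each $X_i$ is an $i$-packing. The packing chromatic number $\chi_\rho(G)$ is the smallest integer $p$ for which $G$ has a packing $p$-coloring. *)

theory Defs
  imports
    "Graph_Theory.Graph_Theory"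
    "HOL-Library.Extended_Nat"
    "HOL-Library.Disjoint_Sets"
begin

text \<open>
  An undirected graph is represented, as usual in the Graph-Theory library, by a symmetric
  digraph. The library locale called graph cannot be used because it requires finitely many
  vertices.
\<close>

definition distance_graph :: "nat \<Rightarrow> nat \<Rightarrow> int pair_pre_digraph" where
  "distance_graph k t =
     \<lparr> pverts = UNIV, parcs = {(i, j). i \<noteq> j \<and> \<bar>i - j\<bar> \<in> {int k, int t}} \<rparr>"

interpretation distance_graph: pair_bidirected_digraph "distance_graph k t" for k t
  by unfold_locales
    (auto simp: distance_graph_def symmetric_def arcs_ends_def arc_to_ends_def abs_minus_commute intro!: symI)

text \<open>
  The least number of arcs of a walk between two vertices. The value is \<open>\<infinity>\<close> for
  vertices in different components, which does not occur in connected graphs.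
\<close>

definition graph_dist :: "('a, 'b) pre_digraph \<Rightarrow> 'a \<Rightarrow> 'a \<Rightarrow> ereal" where
  "graph_dist G u v = wf_digraph.\<mu> G (\<lambda>_. 1) u v"

definition is_packing :: "('a, 'b) pre_digraph \<Rightarrow> nat \<Rightarrow> 'a set \<Rightarrow> bool" where
  "is_packing G i X \<longleftrightarrow>
     X \<subseteq> verts G \<and> (\<forall>u\<in>X. \<forall>v\<in>X. u \<noteq> v \<longrightarrow> graph_dist G u v > ereal (real i))"

definition packing_coloring :: "('a, 'b) pre_digraph \<Rightarrow> nat \<Rightarrow> (nat \<Rightarrow> 'a set) \<Rightarrow> bool" where
  "packing_coloring G p X \<longleftrightarrow>
     (\<Union>i\<in>{1..p}. X i) = verts G \<and> disjoint_family_on X {1..p} \<and> (\<forall>i\<in>{1..p}. is_packing G i (X i))"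

text \<open>
  Extended natural numbers are used so that a graph without any packing coloring gets the
  value \<open>\<infinity>\<close> instead of an arbitrary number.
\<close>

definition packing_chromatic_number :: "('a, 'b) pre_digraph \<Rightarrow> enat" where
  "packing_chromatic_number G = (INF p\<in>{p. \<exists>X. packing_coloring G p X}. enat p)"

end

theory Submission
  imports Defs
begin

text \<open>
  Write every integer as \<open>x + t y\<close> with \<open>0 \<le> x < t\<close>. A step of \<open>1\<close> or \<open>t\<close> then moves by one cell
  horizontally or vertically, so up to the distances that matter here the graph looks like the square
  grid, wound into a cylinder: running off the right end of row \<open>y\<close> leads to the left end of
  row \<open>y + 1\<close>.

  The square grid has a packing coloring with 17 colors that repeats with period 24 in both
  directions (constant \<open>grid_pattern\<close>). Copying it to the integers works at once except at the
  place where the rows are joined: it would need \<open>24 dvd t\<close>, and a vertical offset by one. Both defects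
  are repaired by \<^emph>\<open>seams\<close>, single columns cut into the pattern. Inserting a column pushes the
  two sides of the pattern apart by one cell, hence it may be combined with a vertical shift by one
  cell in either direction without bringing any two cells closer together. With \<open>t mod 24\<close> seams the
  remaining width is a multiple of 24. Since \<open>t\<close> is odd, so is the number of seams, and shifts
  that alternate in direction add up to the offset by one that the junction of the rows requires.
  All this respects the color 1, which is given to the odd integers: they form one color class of
  a chessboard, and so do the cells of color 1 in the grid pattern.

  What remains are the even integers in the seams. The seams are so far apart that each of them can
  be colored on its own, with the 13 colors from 18 to 30. Every second cell of a seam is to be colored,
  and cells that are \<open>b\<close> places apart among these have distance \<open>2 b\<close>, so any two uses of
  color \<open>c\<close> must be more than \<open>c / 2\<close> places apart. Thus colors 18 and 19 can each fill every tenth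
  place at best, colors 20 and 21 every eleventh, and so on up to color 30 with every sixteenth.
  As \<open>2/10 + 2/11 + 2/12 + 2/13 + 2/14 + 2/15 + 1/16\<close> is about 1.04, a complete filling is not
  excluded by counting, and the constant \<open>seam_pattern\<close> is one of period 162.

  The two patterns have no conceptual derivation. That they have the required properties is a finite
  check on a torus and on a circle, respectively; that the whole coloring inherits these properties
  rests on the lemmas \<open>grid_displacement\<close> and \<open>seam_displacement\<close>.
\<close>

section \<open>Distances on a circle\<close>

definition circular_distance :: "int \<Rightarrow> int \<Rightarrow> int \<Rightarrow> int" where
  "circular_distance n x x' = min \<bar>x' - x\<bar> (n - \<bar>x' - x\<bar>)"

text \<open>
  Among all displacements between two residue classes the circular distance is the shortest one.
  Hence a bound on circular distances, of which there are finitely many, bounds the displacements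
  between all cells of the periodic pattern.
\<close>

lemma circular_distance_le:
  fixes a n x :: int
  assumes "0 \<le> x" "x < n"
  shows "circular_distance n x ((x + a) mod n) \<le> \<bar>a\<bar>"
proof -
  define q where "q = (x + a) div n"
  define r where "r = (x + a) mod n"
  have a: "a = n * q + (r - x)" unfolding q_def r_def by (simp add: algebra_simps)
  have r: "0 \<le> r" "r < n" using assms by (auto simp: r_def)
  consider "q = 0" | "q \<ge> 1" | "q \<le> -1" by linarith
  then have "min \<bar>r - x\<bar> (n - \<bar>r - x\<bar>) \<le> \<bar>a\<bar>"
  proof cases
    case 1
    then show ?thesis using a by simp
  next
    case 2
    then have "n * q \<ge> n * 1" using assms by (intro mult_left_mono) auto
    then show ?thesis using a r assms by linarith
  next
    case 3
    then have "n * q \<le> n * (-1)" using assms by (intro mult_left_mono) auto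
    then show ?thesis using a r assms by linarith
  qed
  then show ?thesis by (simp add: circular_distance_def r_def)
qed

lemma circular_distance_sym: "circular_distance n x x' = circular_distance n x' x"
  by (simp add: circular_distance_def abs_minus_commute)

text \<open>
  For a symmetric relation, comparing each list entry only with the later ones is enough. This halves
  the work in the finite checks below.
\<close>

lemma sorted_wrt_symmetricD:
  assumes "sorted_wrt P ps" "p \<in> set ps" "q \<in> set ps" "p \<noteq> q" "\<And>p q. P p q \<Longrightarrow> P q p"
  shows "P p q"
  using assms by (induction ps) auto

section \<open>A packing coloring of the square grid with 17 colors\<close>

definition grid_pattern :: "nat list list" where
  "grid_pattern =
   [[ 5,  1,  4,  1, 15,  1,  3,  1,  2,  1,  3,  1,  6,  1,  4,  1,  7,  1,  3,  1,  2,  1,  3,  1],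
    [ 1,  3,  1,  2,  1,  8,  1,  5,  1, 11,  1,  2,  1,  3,  1,  2,  1, 10,  1,  5,  1,  4,  1,  2],
    [12,  1,  6,  1,  3,  1,  2,  1,  3,  1,  4,  1,  9,  1,  5,  1,  3,  1,  2,  1,  3,  1,  7,  1],
    [ 1,  2,  1,  5,  1,  4,  1, 10,  1,  2,  1,  3,  1,  2,  1, 13,  1,  4,  1, 14,  1,  2,  1,  3],
    [ 4,  1,  3,  1,  2,  1,  3,  1,  6,  1,  5,  1,  7,  1,  3,  1,  2,  1,  3,  1,  8,  1,  5,  1],
    [ 1, 11,  1,  7,  1,  9,  1,  2,  1,  3,  1,  2,  1,  4,  1,  6,  1,  5,  1,  2,  1,  3,  1,  2],
    [ 3,  1,  2,  1,  3,  1,  5,  1,  4,  1, 12,  1,  3,  1,  2,  1,  3,  1,  7,  1,  4,  1,  6,  1],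
    [ 1,  5,  1,  4,  1,  2,  1,  3,  1,  2,  1,  8,  1,  5,  1, 11,  1,  2,  1,  3,  1,  2,  1, 10],
    [ 2,  1,  3,  1, 13,  1, 17,  1,  7,  1,  3,  1,  2,  1,  3,  1,  4,  1,  9,  1,  5,  1,  3,  1],
    [ 1,  8,  1,  2,  1,  3,  1,  2,  1,  5,  1,  4,  1, 10,  1,  2,  1,  3,  1,  2,  1, 15,  1,  4],
    [ 3,  1,  6,  1,  5,  1,  4,  1,  3,  1,  2,  1,  3,  1,  7,  1,  5,  1,  6,  1,  3,  1,  2,  1],
    [ 1,  2,  1,  3,  1,  2,  1, 11,  1,  6,  1,  9,  1,  2,  1,  3,  1,  2,  1,  4,  1,  7,  1,  5],
    [ 9,  1,  4,  1,  7,  1,  3,  1,  2,  1,  3,  1,  5,  1,  4,  1,  8,  1,  3,  1,  2,  1,  3,  1],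
    [ 1,  3,  1,  2,  1, 10,  1,  5,  1,  4,  1,  2,  1,  3,  1,  2,  1, 12,  1,  5,  1, 11,  1,  2],
    [14,  1,  5,  1,  3,  1,  2,  1,  3,  1, 15,  1, 13,  1,  6,  1,  3,  1,  2,  1,  3,  1,  4,  1],
    [ 1,  2,  1, 16,  1,  4,  1,  8,  1,  2,  1,  3,  1,  2,  1,  5,  1,  4,  1, 10,  1,  2,  1,  3],
    [ 7,  1,  3,  1,  2,  1,  3,  1,  7,  1,  5,  1,  4,  1,  3,  1,  2,  1,  3,  1,  6,  1,  5,  1],
    [ 1,  4,  1,  6,  1,  5,  1,  2,  1,  3,  1,  2,  1, 11,  1,  7,  1,  9,  1,  2,  1,  3,  1,  2],
    [ 3,  1,  2,  1,  3,  1, 12,  1,  4,  1,  6,  1,  3,  1,  2,  1,  3,  1,  5,  1,  4,  1,  8,  1],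
    [ 1,  5,  1, 11,  1,  2,  1,  3,  1,  2,  1, 10,  1,  5,  1,  4,  1,  2,  1,  3,  1,  2,  1, 13],
    [ 2,  1,  3,  1,  4,  1,  9,  1,  5,  1,  3,  1,  2,  1,  3,  1,  6,  1, 17,  1,  7,  1,  3,  1],
    [ 1, 10,  1,  2,  1,  3,  1,  2,  1, 14,  1,  4,  1,  8,  1,  2,  1,  3,  1,  2,  1,  5,  1,  4],
    [ 3,  1,  7,  1,  5,  1,  6,  1,  3,  1,  2,  1,  3,  1, 16,  1,  5,  1,  4,  1,  3,  1,  2,  1],
    [ 1,  2,  1,  3,  1,  2,  1,  4,  1,  7,  1,  5,  1,  2,  1,  3,  1,  2,  1, 11,  1,  6,  1,  9]]"

definition grid_cells :: "(int \<times> int \<times> nat) list" where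
  "grid_cells = [(x, y, c). (y, row) \<leftarrow> zip [0..23] grid_pattern, (x, c) \<leftarrow> zip [0..23] row]"

text \<open>
  Color 1 is governed by parity instead: its cells are one color class of a chessboard.
\<close>

lemma grid_check:
  "\<forall>k\<in>set [2..<18]. sorted_wrt (\<lambda>(x, y) (x', y').
       circular_distance 24 x x' + circular_distance 24 y y' > int k)
     (map (\<lambda>(x, y, c). (x, y)) (filter (\<lambda>(x, y, c). c = k) grid_cells))"
  by code_simp

lemma grid_shape: "length grid_pattern = 24 \<and> list_all (\<lambda>row. length row = 24) grid_pattern"
  by code_simp

lemma grid_colors:
  "list_all (\<lambda>(x, y, c). if even (x + y) then 2 \<le> c \<and> c \<le> 17 else c = 1) grid_cells"
  by code_simp

definition grid_color :: "int \<Rightarrow> int \<Rightarrow> nat" where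
  "grid_color x y = grid_pattern ! nat (y mod 24) ! nat (x mod 24)"

lemma grid_color_cong:
  "x mod 24 = x' mod 24 \<Longrightarrow> y mod 24 = y' mod 24 \<Longrightarrow> grid_color x y = grid_color x' y'"
  by (simp add: grid_color_def)

lemma grid_cell: "(x mod 24, y mod 24, grid_color x y) \<in> set grid_cells"
proof -
  let ?x = "nat (x mod 24)" and ?y = "nat (y mod 24)"
  have xy: "?x < 24" "?y < 24" by auto
  have len: "length grid_pattern = 24" "length (grid_pattern ! ?y) = 24"
    using grid_shape xy by (auto simp: list_all_length)
  have "(y mod 24, grid_pattern ! ?y) \<in> set (zip [0..23] grid_pattern)"
    using xy len by (auto simp: in_set_zip intro!: exI[of _ ?y])
  moreover have "(x mod 24, grid_color x y) \<in> set (zip [0..23] (grid_pattern ! ?y))"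
    using xy len by (auto simp: in_set_zip grid_color_def intro!: exI[of _ ?x])
  ultimately show ?thesis unfolding grid_cells_def by force
qed

lemma grid_color_range:
  "if even (x + y) then grid_color x y \<in> {2..17} else grid_color x y = 1"
proof -
  have "even (x mod 24 + y mod 24) \<longleftrightarrow> even (x + y)" by presburger
  then show ?thesis using grid_colors grid_cell[of x y] by (auto simp: list_all_iff)
qed

text \<open>
  The finite check excludes two cells of one color in different places of the torus. A cell and
  its own translates by the period are too far apart because the period 24 exceeds all the colors.
\<close>

lemma grid_color_packing:
  assumes "even (x + y)"
    and eq: "grid_color (x + a) (y + b) = grid_color x y"
    and close: "\<bar>a\<bar> + \<bar>b\<bar> \<le> int (grid_color x y)"
  shows "a = 0 \<and> b = 0"
proof -
  let ?c = "grid_color x y"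
  let ?p = "(x mod 24, y mod 24)" and ?q = "((x + a) mod 24, (y + b) mod 24)"
  let ?far = "\<lambda>(x, y) (x', y'). circular_distance 24 x x' + circular_distance 24 y y' > int ?c"
  let ?cells = "map (\<lambda>(x, y, c). (x, y)) (filter (\<lambda>(x, y, c). c = ?c) grid_cells)"
  have c: "2 \<le> ?c" "?c \<le> 17" using grid_color_range[of x y] assms(1) by auto
  have "circular_distance 24 (x mod 24) ((x + a) mod 24) \<le> \<bar>a\<bar>"
    using circular_distance_le[of "x mod 24" 24 a] by (simp add: mod_simps)
  moreover have "circular_distance 24 (y mod 24) ((y + b) mod 24) \<le> \<bar>b\<bar>"
    using circular_distance_le[of "y mod 24" 24 b] by (simp add: mod_simps)
  ultimately have near: "\<not> ?far ?p ?q" using close by simp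
  have pairs: "sorted_wrt ?far ?cells"
    by (rule bspec[OF grid_check]) (use c in \<open>simp only: set_upt atLeastLessThan_iff, simp\<close>)
  have "?p \<in> set ?cells" "?q \<in> set ?cells"
    using grid_cell[of x y] grid_cell[of "x + a" "y + b"] eq by force+
  moreover have "?far q p" if "?far p q" for p q
    using that by (cases p; cases q) (simp add: circular_distance_sym)
  ultimately have "?p = ?q" using sorted_wrt_symmetricD[OF pairs, of ?p ?q] near by blast
  then have "24 dvd a" "24 dvd b" by (auto simp: mod_eq_dvd_iff)
  moreover have "\<bar>a\<bar> < 24" "\<bar>b\<bar> < 24" using close c by linarith+
  ultimately show ?thesis using dvd_imp_le_int[of a 24] dvd_imp_le_int[of b 24] by linarith
qed

section \<open>A periodic coloring of a seam with colors 18 to 30\<close>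

definition seam_pattern :: "nat list" where
  "seam_pattern =
   [26, 22, 18, 28, 23, 27, 24, 19, 20, 25, 21, 29, 18, 22, 30, 26, 23, 19, 28, 20, 24, 21, 18, 25, 27, 22, 29,
    19, 23, 26, 20, 30, 18, 24, 21, 28, 25, 22, 19, 27, 23, 20, 18, 26, 29, 21, 24, 30, 19, 22, 28, 25, 18, 27,
    20, 23, 21, 26, 19, 29, 24, 22, 18, 30, 25, 20, 28, 27, 19, 21, 23, 26, 18, 22, 24, 29, 20, 25, 19, 30, 21,
    27, 23, 18, 28, 22, 26, 24, 19, 20, 25, 21, 29, 18, 23, 30, 27, 22, 19, 28, 20, 24, 21, 18, 25, 26, 23, 29,
    19, 22, 27, 20, 30, 18, 24, 21, 28, 25, 23, 19, 26, 22, 20, 18, 27, 29, 21, 24, 30, 19, 23, 28, 25, 18, 26,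
    20, 22, 21, 27, 19, 29, 24, 23, 18, 30, 25, 20, 28, 26, 19, 21, 22, 27, 18, 23, 24, 29, 20, 25, 19, 30, 21]"

definition seam_cells :: "(int \<times> nat) list" where
  "seam_cells = zip [0..161] seam_pattern"

text \<open>
  The factor 2 accounts for the odd integers between the cells of a seam: neighboring entries of
  the pattern are used for cells at distance 2.
\<close>

lemma seam_check:
  "\<forall>k\<in>set [18..<31]. sorted_wrt (\<lambda>y y'. 2 * circular_distance 162 y y' > int k)
     (map fst (filter (\<lambda>(y, c). c = k) seam_cells))"
  by code_simp

lemma seam_shape: "length seam_pattern = 162 \<and> list_all (\<lambda>c. 18 \<le> c \<and> c \<le> 30) seam_pattern"
  by code_simp

definition seam_color :: "int \<Rightarrow> nat" where
  "seam_color y = seam_pattern ! nat (y mod 162)"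

lemma seam_color_range: "seam_color y \<in> {18..30}"
  using seam_shape by (auto simp: seam_color_def list_all_length nat_less_iff)

lemma seam_cell: "(y mod 162, seam_color y) \<in> set seam_cells"
  using seam_shape
  by (auto simp: seam_cells_def seam_color_def in_set_zip nat_less_iff intro!: exI[of _ "nat (y mod 162)"])

lemma seam_color_packing:
  assumes eq: "seam_color (y + b) = seam_color y"
    and close: "2 * \<bar>b\<bar> \<le> int (seam_color y)"
  shows "b = 0"
proof -
  let ?c = "seam_color y"
  let ?p = "y mod 162" and ?q = "(y + b) mod 162"
  let ?far = "\<lambda>y y'. 2 * circular_distance 162 y y' > int ?c"
  let ?cells = "map fst (filter (\<lambda>(y, c). c = ?c) seam_cells)"
  have c: "18 \<le> ?c" "?c \<le> 30" using seam_color_range[of y] by auto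
  have "circular_distance 162 ?p ?q \<le> \<bar>b\<bar>"
    using circular_distance_le[of "y mod 162" 162 b] by (simp add: mod_simps)
  then have near: "\<not> ?far ?p ?q" using close by simp
  have pairs: "sorted_wrt ?far ?cells"
    by (rule bspec[OF seam_check]) (use c in \<open>simp only: set_upt atLeastLessThan_iff, simp\<close>)
  have "?p \<in> set ?cells" "?q \<in> set ?cells"
    using seam_cell[of y] seam_cell[of "y + b"] eq by force+
  moreover have "?far q p" if "?far p q" for p q
    using that by (simp add: circular_distance_sym)
  ultimately have "?p = ?q" using sorted_wrt_symmetricD[OF pairs, of ?p ?q] near by blast
  then have "162 dvd b" by (metis add_diff_cancel_left' mod_eq_dvd_iff)
  moreover have "\<bar>b\<bar> < 162" using close c by linarith
  ultimately show ?thesis using dvd_imp_le_int[of b 162] by linarith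
qed

section \<open>Distances in the distance graph\<close>

lemma distance_graph_walk_displacement:
  assumes "pre_digraph.awalk (with_proj (distance_graph 1 t)) u p v"
  shows "\<exists>a b. v = u + a + b * int t \<and> \<bar>a\<bar> + \<bar>b\<bar> \<le> int (length p)"
  using assms
proof (induction p arbitrary: u)
  case Nil
  then have "v = u + 0 + 0 * int t" by (simp add: pre_digraph.awalk_def pre_digraph.cas.simps)
  then show ?case by fastforce
next
  case (Cons e p)
  obtain w where e: "e = (u, w)" "\<bar>u - w\<bar> \<in> {1, int t}"
    and w: "pre_digraph.awalk (with_proj (distance_graph 1 t)) w p v"
    using Cons.prems
    by (cases e) (auto simp: pre_digraph.awalk_def pre_digraph.cas.simps distance_graph_def)
  from Cons.IH[OF w] obtain a b where ab: "v = w + a + b * int t" "\<bar>a\<bar> + \<bar>b\<bar> \<le> int (length p)"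
    by blast
  consider "w = u + 1" | "w = u - 1" | "w = u + int t" | "w = u - int t"
    using e(2) by (auto simp: abs_if split: if_splits)
  then show ?case
  proof cases
    case 1 with ab show ?thesis by (intro exI[of _ "a + 1"] exI[of _ b]) auto
  next
    case 2 with ab show ?thesis by (intro exI[of _ "a - 1"] exI[of _ b]) auto
  next
    case 3 with ab show ?thesis by (intro exI[of _ a] exI[of _ "b + 1"]) (auto simp: algebra_simps)
  next
    case 4 with ab show ?thesis by (intro exI[of _ a] exI[of _ "b - 1"]) (auto simp: algebra_simps)
  qed
qed

text \<open>
  A lower bound for all displacements is one for all walks. Displacements with \<open>a < 0\<close> reduce
  to those with \<open>a \<ge> 0\<close> by exchanging the two vertices.
\<close>

lemma distance_graph_packingI:
  assumes "\<And>u a b. u \<in> X \<Longrightarrow> u + a + b * int t \<in> X \<Longrightarrow> 0 \<le> a \<Longrightarrow> \<bar>a\<bar> + \<bar>b\<bar> \<le> int i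
             \<Longrightarrow> a = 0 \<and> b = 0"
  shows "is_packing (with_proj (distance_graph 1 t)) i X"
proof -
  let ?G = "with_proj (distance_graph 1 t)"
  have wf: "wf_digraph ?G"
    by (rule wf_digraph_wp_iff[THEN iffD2]) unfold_locales
  have far: "int i < \<bar>a\<bar> + \<bar>b\<bar>"
    if "u \<in> X" "v \<in> X" "u \<noteq> v" "v = u + a + b * int t" for u v a b
  proof (rule ccontr)
    assume le: "\<not> int i < \<bar>a\<bar> + \<bar>b\<bar>"
    have "a = 0 \<and> b = 0"
    proof (cases "0 \<le> a")
      case True
      then show ?thesis using assms[of u a b] that le by simp
    next
      case False
      then show ?thesis using assms[of v "- a" "- b"] that le by simp
    qed
    with that show False by simp
  qed
  have "ereal (real i) < graph_dist ?G u v" if uv: "u \<in> X" "v \<in> X" "u \<noteq> v" for u v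
  proof -
    have "ereal (real (Suc i)) \<le> graph_dist ?G u v"
      unfolding graph_dist_def wf_digraph.\<mu>_def[OF wf]
    proof (rule INF_greatest)
      fix p assume "p \<in> {p. pre_digraph.awalk ?G u p v}"
      then obtain a b where "v = u + a + b * int t" "\<bar>a\<bar> + \<bar>b\<bar> \<le> int (length p)"
        using distance_graph_walk_displacement by blast
      with far[OF uv] have "Suc i \<le> length p" by fastforce
      moreover have "wf_digraph.awalk_cost (\<lambda>_. 1) p = real (length p)"
        by (simp add: wf_digraph.awalk_cost_def[OF wf] sum_list_triv)
      ultimately show "ereal (real (Suc i)) \<le> ereal (wf_digraph.awalk_cost (\<lambda>_. 1) p)" by simp
    qed
    then show ?thesis by (rule less_le_trans[rotated]) simp
  qed
  then show ?thesis by (simp add: is_packing_def distance_graph_def)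
qed

section \<open>Winding the grid pattern into a cylinder\<close>

text \<open>
  The seams are the columns \<open>0, 32, 64, \<dots>\<close>. The distance 32 exceeds all the colors, so vertices in
  different seams never conflict, and two vertices of the same color that are no more than this color
  apart have at most one seam between them. There are at most 23 seams, so the blocks of 32 columns that
  start with a seam end before column 736. A bound of 767 leaves 31 further columns, so that vertices
  within this distance of the next row are past all the seams of their own row.
\<close>

locale seamed_strip =
  fixes t :: int
  assumes odd_t: "odd t" and t_ge: "t \<ge> 767"
begin

definition seams :: int where "seams = t mod 24"

definition is_seam :: "int \<Rightarrow> bool" where
  "is_seam x \<longleftrightarrow> x mod 32 = 0 \<and> x div 32 < seams"

definition seams_upto :: "int \<Rightarrow> int" where
  "seams_upto x = min (x div 32 + 1) seams"

text \<open>
  The cell of the grid pattern that is used for a vertex outside the seams. The seams to the left are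
  removed, and the parity of their number realizes vertical shifts that alternate in direction.
\<close>

definition grid_x :: "int \<Rightarrow> int" where
  "grid_x i = i mod t - seams_upto (i mod t)"

definition grid_y :: "int \<Rightarrow> int" where
  "grid_y i = i div t + seams_upto (i mod t) mod 2"

text \<open>
  In a fixed column the even integers occur in every second row, since \<open>t\<close> is odd. Halving the row
  number therefore enumerates the vertices of a seam that are not of color 1.
\<close>

definition color :: "int \<Rightarrow> nat" where
  "color i = (if odd i then 1
              else if is_seam (i mod t) then seam_color (i div t div 2)
              else grid_color (grid_x i) (grid_y i))"

lemma seams_bounds: "1 \<le> seams" "seams \<le> 23" "odd seams"
proof -
  show "odd seams" using odd_t unfolding seams_def by presburger
  moreover have "0 \<le> seams" "seams < 24" by (auto simp: seams_def)
  ultimately show "1 \<le> seams" "seams \<le> 23" by (auto simp: order_le_less)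
qed

text \<open>
  Between two vertices on both sides of a seam there is the seam itself, so they are at least two
  columns apart. This is why different vertices keep different cells when the seam is removed.
\<close>

lemma seams_upto_step:
  assumes "0 \<le> a" "a \<le> 31" "\<not> is_seam x" "\<not> is_seam (x + a)"
  shows "seams_upto (x + a) = seams_upto x \<or> seams_upto (x + a) = seams_upto x + 1 \<and> a \<ge> 2"
proof -
  define q r where "q = x div 32" and "r = x mod 32"
  have x: "x = 32 * q + r" "0 \<le> r" "r < 32" by (auto simp: q_def r_def)
  show ?thesis
  proof (cases "r + a < 32")
    case True
    then have "(x + a) div 32 = q" using x assms(1) by linarith
    then show ?thesis by (simp add: seams_upto_def q_def)
  next
    case False
    then have next_block: "(x + a) div 32 = q + 1"
      using x assms(2) by linarith
    then have "(x + a) mod 32 = r + a - 32"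
      using div_mult_mod_eq[of "x + a" 32] x by linarith
    then have "a \<ge> 2" if "q + 1 < seams"
      using that assms(3,4) x False next_block by (auto simp: is_seam_def simp flip: q_def r_def)
    then show ?thesis using next_block by (auto simp: seams_upto_def min_def simp flip: q_def)
  qed
qed

lemma position_shift:
  assumes "0 \<le> a" "a \<le> 31"
  obtains (same_row) "i mod t + a < t" "(i + a + b * t) mod t = i mod t + a"
      "(i + a + b * t) div t = i div t + b"
    | (next_row) "t \<le> i mod t + a" "(i + a + b * t) mod t = i mod t + a - t"
      "(i + a + b * t) div t = i div t + b + 1"
proof -
  have t: "t > 0" using t_ge by simp
  have r: "0 \<le> i mod t" "i mod t < t" using t by auto
  have *: "i + a + b * t = (i mod t + a) + (i div t + b) * t"
    using div_mult_mod_eq[of i t] by (simp add: algebra_simps)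
  show thesis
  proof (cases "i mod t + a < t")
    case True
    then have "(i mod t + a) mod t = i mod t + a" "(i mod t + a) div t = 0"
      using r assms by auto
    then show thesis using True t unfolding * by (intro same_row) (auto simp: *)
  next
    case False
    then have "0 \<le> i mod t + a - t" "i mod t + a - t < t" using r assms t_ge by linarith+
    then have "(i mod t + a) mod t = i mod t + a - t" "(i mod t + a) div t = 1"
      using False t mod_pos_geq[of t "i mod t + a"] div_pos_geq[of t "i mod t + a"]
      by (simp_all only: not_less mod_pos_pos_trivial div_pos_pos_trivial)
    then show thesis using False t unfolding * by (intro next_row) (auto simp: *)
  qed
qed

lemma even_position: "even i \<longleftrightarrow> even (i mod t + i div t)"
proof -
  have "even i \<longleftrightarrow> even (i mod t + i div t * t)" by simp
  then show ?thesis using odd_t by (simp only: even_add even_mult_iff) simp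
qed

text \<open>
  Each seam changes both coordinates by one, so cells of color 1 are still those of the odd integers.
\<close>

lemma grid_parity: "even (grid_x i + grid_y i) \<longleftrightarrow> even i"
proof -
  have "even (x - m + (y + m mod 2)) \<longleftrightarrow> even (x + y)" for x y m :: int by presburger
  then show ?thesis by (simp only: even_position[of i] grid_x_def grid_y_def)
qed

text \<open>
  Removing a seam shortens the horizontal displacement by one and changes the vertical one by at most
  one, so a short displacement between vertices yields a short displacement between cells. The
  junction of the rows behaves like any other seam: the first seam of the next row is crossed, the
  width \<open>t - seams\<close> of the pattern is invisible modulo 24, and the step to the next row is
  the vertical shift.
\<close>

lemma grid_displacement:
  assumes "0 \<le> a" "a \<le> 31" "\<not> is_seam (i mod t)" "\<not> is_seam ((i + a + b * t) mod t)"
  obtains a' b' where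
    "grid_x (i + a + b * t) mod 24 = (grid_x i + a') mod 24"
    "grid_y (i + a + b * t) = grid_y i + b'"
    "\<bar>a'\<bar> + \<bar>b'\<bar> \<le> \<bar>a\<bar> + \<bar>b\<bar>"
    "a' = 0 \<Longrightarrow> b' = 0 \<Longrightarrow> a = 0 \<and> b = 0"
  using assms(1,2)
proof (cases rule: position_shift[of a i b])
  case same_row
  let ?x = "i mod t"
  let ?m = "seams_upto ?x" and ?m' = "seams_upto (?x + a)"
  show ?thesis
  proof (cases "?m' = ?m")
    case True
    then show ?thesis using same_row
      by (intro that[of a b]) (auto simp: grid_x_def grid_y_def algebra_simps)
  next
    case False
    have x: "?m' = ?m + 1" "a \<ge> 2"
      using False seams_upto_step[of a ?x] assms same_row by auto
    then show ?thesis using same_row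
      by (intro that[of "a - 1" "b + (?m' mod 2 - ?m mod 2)"])
         (auto simp: grid_x_def grid_y_def algebra_simps)
  qed
next
  case next_row
  let ?x = "i mod t"
  have x: "?x < t" using t_ge by simp
  have "?x \<ge> 736" "?x + a - t \<ge> 0" "?x + a - t \<le> 30" using next_row x assms t_ge by linarith+
  then have m: "seams_upto ?x = seams" "seams_upto (?x + a - t) = 1"
    using seams_bounds by (auto simp: seams_upto_def)
  have "?x + a - t \<noteq> 0" using assms next_row seams_bounds by (auto simp: is_seam_def)
  then have a: "a \<ge> 2" using next_row x by linarith
  have "24 dvd seams - t" by (simp add: seams_def flip: mod_eq_dvd_iff)
  moreover have "grid_x (i + a + b * t) = grid_x i + (a - 1) - (t - seams)"
    using next_row m by (simp add: grid_x_def)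
  ultimately have "grid_x (i + a + b * t) mod 24 = (grid_x i + (a - 1)) mod 24"
    by (simp add: mod_eq_dvd_iff)
  moreover have "grid_y (i + a + b * t) = grid_y i + (b + 1)"
    using next_row m seams_bounds by (auto simp: grid_y_def odd_iff_mod_2_eq_one)
  ultimately show ?thesis using a by (intro that[of "a - 1" "b + 1"]) auto
qed

lemma seam_displacement:
  assumes "0 \<le> a" "a \<le> 31" "is_seam (i mod t)" "is_seam ((i + a + b * t) mod t)"
  shows "a = 0" "(i + a + b * t) mod t = i mod t" "(i + a + b * t) div t = i div t + b"
proof -
  have "a = 0 \<and> (i + a + b * t) mod t = i mod t \<and> (i + a + b * t) div t = i div t + b"
    using assms(1,2)
  proof (cases rule: position_shift[of a i b])
    case same_row
    moreover have "a = 0" if "x mod 32 = 0" "(x + a) mod 32 = 0" for x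
      using that assms(1,2) by presburger
    ultimately have "a = 0" using assms(3,4) unfolding is_seam_def by metis
    then show ?thesis using same_row by simp
  next
    case next_row
    have "i mod t \<ge> 736" using next_row assms t_ge by linarith
    then have "\<not> is_seam (i mod t)" using seams_bounds by (auto simp: is_seam_def)
    then show ?thesis using assms by simp
  qed
  then show "a = 0" "(i + a + b * t) mod t = i mod t" "(i + a + b * t) div t = i div t + b" by auto
qed

lemma color_cases:
  obtains (one) "odd i" "color i = 1"
  | (grid) "even i" "\<not> is_seam (i mod t)" "color i = grid_color (grid_x i) (grid_y i)" "color i \<in> {2..17}"
  | (seam) "even i" "is_seam (i mod t)" "color i = seam_color (i div t div 2)" "color i \<in> {18..30}"
  using grid_color_range[of "grid_x i" "grid_y i"] grid_parity[of i] seam_color_range[of "i div t div 2"]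
  by (cases "odd i"; cases "is_seam (i mod t)") (auto simp: color_def)

lemma color_range: "color i \<in> {1..30}"
  by (cases rule: color_cases[of i]) auto

text \<open>
  Color 1 is excluded by parity, and the other colors by the properties of the grid pattern and the
  seam pattern, transferred along the displacement lemmas. Colors at most 17 and
  at least 18 do not interfere, as they occur only outside and inside the seams, respectively.
\<close>

lemma color_packing:
  assumes eq: "color (i + a + b * t) = color i"
    and a: "0 \<le> a" and close: "\<bar>a\<bar> + \<bar>b\<bar> \<le> int (color i)"
  shows "a = 0 \<and> b = 0"
proof -
  let ?j = "i + a + b * t"
  have "a \<le> 31" using close color_range[of i] a by auto
  note displacement = a this
  show ?thesis
  proof (cases rule: color_cases[of i])
    case one
    then have "odd ?j" using eq by (cases rule: color_cases[of ?j]) auto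
    then have "even (a + b)" using one odd_t by simp
    moreover have "\<bar>a\<bar> + \<bar>b\<bar> \<le> 1" using close one by simp
    ultimately show ?thesis using a by presburger
  next
    case grid
    then have j: "even ?j" "\<not> is_seam (?j mod t)" "color ?j = grid_color (grid_x ?j) (grid_y ?j)"
      using eq by (cases rule: color_cases[of ?j]; auto)+
    from displacement grid(2) j(2) obtain a' b' where
      ab': "grid_x ?j mod 24 = (grid_x i + a') mod 24" "grid_y ?j = grid_y i + b'"
        "\<bar>a'\<bar> + \<bar>b'\<bar> \<le> \<bar>a\<bar> + \<bar>b\<bar>" "a' = 0 \<Longrightarrow> b' = 0 \<Longrightarrow> a = 0 \<and> b = 0"
      by (rule grid_displacement) blast
    have "grid_color (grid_x i + a') (grid_y i + b') = grid_color (grid_x i) (grid_y i)"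
      using ab'(1,2) eq grid(3) j(3) grid_color_cong by metis
    moreover have "\<bar>a'\<bar> + \<bar>b'\<bar> \<le> int (grid_color (grid_x i) (grid_y i))"
      using ab'(3) close grid(3) by simp
    ultimately have "a' = 0 \<and> b' = 0"
      using grid_color_packing grid_parity grid(1) by blast
    then show ?thesis using ab'(4) by blast
  next
    case seam
    then have j: "even ?j" "is_seam (?j mod t)" "color ?j = seam_color (?j div t div 2)"
      using eq by (cases rule: color_cases[of ?j]; auto)+
    note d = seam_displacement[OF displacement seam(2) j(2)]
    have "even b" using d(2,3) seam(1) j(1) even_position[of i] even_position[of ?j] by auto
    then obtain k where k: "b = 2 * k" by blast
    have "seam_color (i div t div 2 + k) = seam_color (i div t div 2)"
      using eq seam(3) j(3) d(3) k by (simp add: add.commute)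
    moreover have "2 * \<bar>k\<bar> \<le> int (seam_color (i div t div 2))"
      using close seam(3) k a by simp
    ultimately have "k = 0" by (rule seam_color_packing)
    then show ?thesis using d(1) k by simp
  qed
qed

end

theorem corollary2:
  fixes t :: nat
  assumes "odd t" and "t \<ge> 825"
  shows "packing_chromatic_number (with_proj (distance_graph 1 t)) \<le> 30"
proof -
  interpret seamed_strip "int t" using assms by unfold_locales auto
  let ?G = "with_proj (distance_graph 1 t)"
  have "packing_coloring ?G 30 (\<lambda>c. {i. color i = c})"
    unfolding packing_coloring_def
  proof (intro conjI ballI)
    show "(\<Union>c\<in>{1..30}. {i. color i = c}) = verts ?G"
      using color_range by (auto simp: distance_graph_def)
    show "disjoint_family_on (\<lambda>c. {i. color i = c}) {1..30}"
      by (auto simp: disjoint_family_on_def)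
    show "is_packing ?G c {i. color i = c}" for c
      by (rule distance_graph_packingI) (use color_packing in auto)
  qed
  then have "packing_chromatic_number ?G \<le> enat 30"
    unfolding packing_chromatic_number_def by (intro INF_lower) blast
  then show ?thesis by (simp add: numeral_eq_enat)
qed

end
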